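(* Let $d\ge2$ and let $K_1,\dots,K_d\subset\mathbb{R}$ be Cantor sets (each given by a construction as in the context), where the convex hull of $K_i$ is $[A_i,B_i]$. If for every $i\in\{1,\dots,d\}$ $$s_{min}\Big(\sum_{j\neq i}(B_j-A_j)\Big)-\kappa\,(B_i-A_i)\ge 0,$$ then $K_1+\cdots+K_d=\{\sum_{i=1}^d x_i: x_i\in K_i,\ 1\le i\le d\}$ is a union of finitely many closed intervals.
   Context: Cantor sets: start with a closed interval $F_0=[A,B]$. In the first step remove $n_1-1$ open intervals from $[A,B]$ so that $n_1\ge 2$ closed intervals remain; $F_1$ is the union of these. Inductively, given $F_k$ (a finite union of closed intervals), from each of its closed intervals remove finitely many (at least one) open intervals so that $m$ closed intervals remain after removing $m-1$ open ones ($m\ge2$ may depend on the interval); $F_{k+1}$ is the union of all remaining closed intervals. The set $K=\bigcap_{k\ge1}F_k$ is called a Cantor set; its convex hull is $[A,B]$. The deleted open intervals are the gaps of $K$, and the closed intervals making up each $F_k$, $k\ge1$, are the bridges of $K$. For a bridge $I$ of $F_k$, $k\ge1$, its father $\hat I$ is the unique interval of $F_{k-1}$ containing $I$. For a gap $G$ deleted in the $k$-th step, $k\ge1$, its father $\hat G$ is the unique interval of $F_{k-1}$ containing $G$. For Cantor sets $K_1,\dots,K_d$, write $F_k^{(i)}$ for the $k$-th stage of the construction of $K_i$ (so $F_1^{(i)}$ is the union of the first-step bridges of $K_i$). With $|\cdot|$ denoting length, $$s_{min}=\min_{1\le i\le d}\inf\{|I|/|\hat I|: I\text{ is a bridge of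 }K_i\},$$ $$\kappa=\max_{1\le i\le d}\sup\{|G|/|\hat G|: G\text{ is a gap of }K_i\text{ with }G\subset F_1^{(i)}\}$$ (so first-step gaps are not counted in $\kappa$). *)

theory Defs
  imports "HOL-Analysis.Analysis"
begin

text \<open>
  A construction of a Cantor set is given by the end points \<open>A\<close>, \<open>B\<close> and a function \<open>D\<close>, where
  \<open>D k J\<close> is the set of open intervals deleted from the interval \<open>J\<close> of the \<open>k\<close>-th stage
  in order to form stage \<open>k + 1\<close>. Values \<open>D k J\<close> for other sets \<open>J\<close> are irrelevant.
\<close>

type_synonym deletion_rule = "nat \<Rightarrow> real set \<Rightarrow> real set set"

text \<open>
  Deleting \<open>m - 1\<close> pairwise disjoint nonempty open subintervals from a closed interval leaves
  exactly \<open>m\<close> closed intervals, namely the connected components of what remains.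
\<close>

definition admissible_deletion :: "real set \<Rightarrow> real set set \<Rightarrow> bool" where
  "admissible_deletion J \<G> \<longleftrightarrow>
     finite \<G> \<and> \<G> \<noteq> {} \<and> pairwise disjnt \<G> \<and>
     (\<forall>G\<in>\<G>. G \<subseteq> J \<and> (\<exists>u v. u < v \<and> G = {u<..<v}))"

text \<open>The closed intervals whose union is the set \<open>F\<^sub>k\<close>; for \<open>k \<ge> 1\<close> these are the bridges.\<close>

primrec stage :: "real \<Rightarrow> real \<Rightarrow> deletion_rule \<Rightarrow> nat \<Rightarrow> real set set" where
  "stage A B D 0 = {{A..B}}"
| "stage A B D (Suc k) = (\<Union>J\<in>stage A B D k. components (J - \<Union>(D k J)))"

text \<open>The gaps deleted in step \<open>k + 1\<close>.\<close>

definition gaps :: "real \<Rightarrow> real \<Rightarrow> deletion_rule \<Rightarrow> nat \<Rightarrow> real set set" where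
  "gaps A B D k = (\<Union>J\<in>stage A B D k. D k J)"

text \<open>
  Something must be deleted from every interval of every stage. In particular no interval of
  any stage is a single point, since a point contains no nonempty open interval.
\<close>

definition cantor_construction :: "real \<Rightarrow> real \<Rightarrow> deletion_rule \<Rightarrow> bool" where
  "cantor_construction A B D \<longleftrightarrow>
     A < B \<and> (\<forall>k. \<forall>J\<in>stage A B D k. admissible_deletion J (D k J))"

definition cantor_set :: "real \<Rightarrow> real \<Rightarrow> deletion_rule \<Rightarrow> real set" where
  "cantor_set A B D = (\<Inter>k\<in>{1..}. \<Union>(stage A B D k))"

text \<open>
  In the two sets of ratios below, the father of a bridge of stage \<open>k + 1\<close>, or of a gap deleted
  in step \<open>k + 1\<close>, is the interval \<open>J\<close> of stage \<open>k\<close> containing it.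
\<close>

definition bridge_ratios :: "real \<Rightarrow> real \<Rightarrow> deletion_rule \<Rightarrow> real set" where
  "bridge_ratios A B D =
     {measure lborel I / measure lborel J | I J k.
        I \<in> stage A B D (Suc k) \<and> J \<in> stage A B D k \<and> I \<subseteq> J}"

text \<open>Requiring \<open>G \<subseteq> F\<^sub>1\<close> excludes exactly the gaps deleted in the first step.\<close>

definition gap_ratios :: "real \<Rightarrow> real \<Rightarrow> deletion_rule \<Rightarrow> real set" where
  "gap_ratios A B D =
     {measure lborel G / measure lborel J | G J k.
        G \<in> gaps A B D k \<and> J \<in> stage A B D k \<and> G \<subseteq> J \<and> G \<subseteq> \<Union>(stage A B D 1)}"

definition s_min ::
  "nat \<Rightarrow> (nat \<Rightarrow> real) \<Rightarrow> (nat \<Rightarrow> real) \<Rightarrow> (nat \<Rightarrow> deletion_rule) \<Rightarrow> real" where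
  "s_min d A B D = (MIN i\<in>{1..d}. Inf (bridge_ratios (A i) (B i) (D i)))"

definition kappa ::
  "nat \<Rightarrow> (nat \<Rightarrow> real) \<Rightarrow> (nat \<Rightarrow> real) \<Rightarrow> (nat \<Rightarrow> deletion_rule) \<Rightarrow> real" where
  "kappa d A B D = (MAX i\<in>{1..d}. Sup (gap_ratios (A i) (B i) (D i)))"

end

theory Submission
  imports Defs
begin

text \<open>
  Write \<open>L\<^sub>i = B\<^sub>i - A\<^sub>i\<close> and \<open>s\<close> for the minimal bridge ratio. The sum of the Cantor sets turns out
  to be the union of the sums \<open>I\<^sub>1 + \<dots> + I\<^sub>d\<close> over all choices of first-step bridges \<open>I\<^sub>i\<close> of \<open>K\<^sub>i\<close>.
  There are finitely many of these sums, and each is a closed interval. Only the inclusion of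
  \<open>I\<^sub>1 + \<dots> + I\<^sub>d\<close> in the sum of the Cantor sets needs an argument.

  A bridge \<open>I\<^sub>i\<close> in such a sum may be replaced by the union of its children without losing any point,
  as soon as none of the gaps of \<open>I\<^sub>i\<close> is longer than the interval \<open>\<Sum>\<^sub>j\<^sub>\<noteq>\<^sub>i I\<^sub>j\<close>: seen from a point \<open>x\<close>
  of the sum, that interval is a window in which \<open>I\<^sub>i\<close> must contribute, and the window does not
  fit into a gap (lemma \<open>window_meets_component\<close>). The difficulty is to keep this possible forever.
  For this the sizes are compared after rescaling every convex hull to length one, that is through
  \<open>\<rho>\<^sub>i = |I\<^sub>i| / L\<^sub>i\<close>, and the bridges are kept balanced: \<open>s \<rho>\<^sub>j \<le> \<rho>\<^sub>i\<close> for all \<open>i\<close>, \<open>j\<close>. Always split a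
  bridge with the largest \<open>\<rho>\<^sub>i\<close>. Its gaps have length at most
  \<open>\<kappa> \<rho>\<^sub>i L\<^sub>i \<le> \<rho>\<^sub>i s \<Sum>\<^sub>j\<^sub>\<noteq>\<^sub>i L\<^sub>j \<le> \<Sum>\<^sub>j\<^sub>\<noteq>\<^sub>i \<rho>\<^sub>j L\<^sub>j = \<Sum>\<^sub>j\<^sub>\<noteq>\<^sub>i |I\<^sub>j|\<close>
  by the hypothesis and balance, so the split is allowed; and the family remains balanced, because
  the child has relative size at least \<open>s \<rho>\<^sub>i\<close>, where \<open>\<rho>\<^sub>i\<close> was maximal (lemma \<open>balanced_refine\<close>).

  The hypothesis also forces \<open>s > 0\<close>, since \<open>\<kappa> > 0\<close>. As every bridge has a sibling, passing to a
  child then shrinks lengths by a factor of at most \<open>1 - s < 1\<close>, and by balance all bridges become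
  small together. Their left ends belong to the Cantor sets, so \<open>x\<close> is a limit of points of the
  sum of the Cantor sets, which is compact.
\<close>

section \<open>Minkowski sums on the line\<close>

lemma set_plus_atLeastAtMost:
  fixes a b c d :: real
  assumes "a \<le> b" "c \<le> d"
  shows "{a..b} + {c..d} = {a + c..b + d}"
proof
  show "{a..b} + {c..d} \<subseteq> {a + c..b + d}"
    by (auto simp: set_plus_def)
  show "{a + c..b + d} \<subseteq> {a..b} + {c..d}"
  proof
    fix x assume x: "x \<in> {a + c..b + d}"
    \<comment> \<open>the smallest admissible first summand of \<open>x\<close>\<close>
    define y where "y = max a (x - d)"
    have "y \<in> {a..b}" "x - y \<in> {c..d}"
      using x assms by (auto simp: y_def max_def)
    then have "y + (x - y) \<in> {a..b} + {c..d}"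
      by (rule set_plus_intro)
    then show "x \<in> {a..b} + {c..d}" by simp
  qed
qed

lemma sum_atLeastAtMost_sets:
  fixes a b :: "'i \<Rightarrow> real"
  assumes "finite S" "\<And>i. i \<in> S \<Longrightarrow> a i \<le> b i"
  shows "(\<Sum>i\<in>S. {a i..b i}) = {(\<Sum>i\<in>S. a i)..(\<Sum>i\<in>S. b i)}"
  using assms
proof (induction S rule: finite_induct)
  case (insert i S)
  then show ?case
    by (simp add: set_plus_atLeastAtMost sum_mono)
qed simp

lemma compact_sum_sets:
  fixes K :: "'i \<Rightarrow> real set"
  assumes "finite S" "\<And>i. i \<in> S \<Longrightarrow> compact (K i)"
  shows "compact (\<Sum>i\<in>S. K i)"
  using assms
proof (induction S rule: finite_induct)
  case (insert i S)
  then have "compact {x + y | x y. x \<in> K i \<and> y \<in> sum K S}"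
    by (intro compact_sums) auto
  moreover have "{x + y | x y. x \<in> K i \<and> y \<in> sum K S} = K i + sum K S"
    by (auto simp: set_plus_def)
  ultimately show ?case using insert by simp
qed simp

section \<open>Deleting finitely many open intervals from a closed interval\<close>

lemma admissible_deletionE:
  assumes "admissible_deletion J \<G>" "G \<in> \<G>"
  obtains u v where "u < v" "G = {u<..<v}" "{u<..<v} \<subseteq> J"
  using assms unfolding admissible_deletion_def by metis

lemma admissible_deletion_ex_gap:
  assumes "admissible_deletion J \<G>"
  obtains u v where "u < v" "{u<..<v} \<in> \<G>" "{u<..<v} \<subseteq> J"
proof -
  obtain G where "G \<in> \<G>"
    using assms unfolding admissible_deletion_def by blast
  with assms show ?thesis
    using that by (metis admissible_deletionE)
qed

lemma admissible_deletion_nondegenerate: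
  assumes "admissible_deletion {a..b} \<G>"
  shows "a < b"
proof -
  obtain u v where "u < v" "{u<..<v} \<subseteq> {a..b}"
    using admissible_deletion_ex_gap[OF assms] .
  then show ?thesis by (simp add: greaterThanLessThan_subseteq_atLeastAtMost_iff)
qed

lemma component_of_deletion_interval:
  assumes "admissible_deletion {a..b} \<G>" "C \<in> components ({a..b} - \<Union>\<G>)"
  obtains c d where "c \<le> d" "C = {c..d}"
proof -
  have "open (\<Union>\<G>)"
    using assms(1) unfolding admissible_deletion_def by (auto intro!: open_Union)
  then have "compact ({a..b} - \<Union>\<G>)"
    by (intro compact_diff) auto
  then have "compact C"
    using assms(2) compact_components by blast
  then obtain c d where "C = {c..d}"
    using connected_compact_interval_1 in_components_connected[OF assms(2)] by blast
  moreover have "C \<noteq> {}"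
    using assms(2) in_components_nonempty by blast
  ultimately show ?thesis using that by auto
qed

text \<open>
  If one deleted open interval contained an end point of another, the two would overlap.
\<close>

lemma gap_endpoints_survive:
  assumes "admissible_deletion {a..b} \<G>" "{u<..<v} \<in> \<G>" "u < v"
  shows "u \<in> {a..b} - \<Union>\<G>" "v \<in> {a..b} - \<Union>\<G>"
proof -
  have sub: "{u<..<v} \<subseteq> {a..b}"
    using assms unfolding admissible_deletion_def by blast
  have uv: "a \<le> u" "v \<le> b"
    using sub assms(3) by (simp_all add: greaterThanLessThan_subseteq_atLeastAtMost_iff)
  have other: "u \<notin> G \<and> v \<notin> G" if G: "G \<in> \<G>" for G
  proof -
    obtain p q where pq: "p < q" "G = {p<..<q}"
      using admissible_deletionE[OF assms(1) G] .
    show ?thesis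
    proof (cases "G = {u<..<v}")
      case False
      then have "{u<..<v} \<inter> G = {}"
        using assms G unfolding admissible_deletion_def pairwise_def disjnt_def by metis
      then have "\<not> (max u p < min v q)"
        using dense[of "max u p" "min v q"] pq by fastforce
      then show ?thesis using pq assms(3) by (auto simp: max_def min_def split: if_splits)
    qed auto
  qed
  show "u \<in> {a..b} - \<Union>\<G>" "v \<in> {a..b} - \<Union>\<G>"
    using other uv assms(3) by auto
qed

text \<open>
  A component that starts at neither \<open>a\<close> nor the right end of a deleted interval could be
  prolonged to the left, because only finitely many intervals are deleted. Hence components are
  determined by their left ends, of which there are finitely many.
\<close>

lemma finite_components_deletion:
  assumes adm: "admissible_deletion {a..b} \<G>"
  shows "finite (components ({a..b} - \<Union>\<G>))"
proof -
  let ?S = "{a..b} - \<Union>\<G>"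
  have Inf_in: "Inf C \<in> C" if C: "C \<in> components ?S" for C
    by (rule component_of_deletion_interval[OF adm C]) simp
  have "inj_on Inf (components ?S)"
  proof (rule inj_onI)
    fix C C' assume C: "C \<in> components ?S" "C' \<in> components ?S" "Inf C = Inf C'"
    then have "Inf C \<in> C \<inter> C'"
      using Inf_in by (metis IntI)
    then show "C = C'"
      using C components_nonoverlap by blast
  qed
  moreover have "Inf ` components ?S \<subseteq> insert a (Sup ` \<G>)"
  proof (rule image_subsetI, rule ccontr)
    fix C assume C: "C \<in> components ?S" and not: "Inf C \<notin> insert a (Sup ` \<G>)"
    obtain c d where cd: "c \<le> d" "C = {c..d}"
      using component_of_deletion_interval[OF adm C] by blast
    have CS: "{c..d} \<subseteq> ?S"
      using in_components_subset[OF C] cd by simp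
    have c: "a < c" "c \<notin> Sup ` \<G>"
      using CS not cd by auto
    have "\<forall>G\<in>\<G>. eventually (\<lambda>y. y \<notin> G) (at_left c)"
    proof
      fix G assume G: "G \<in> \<G>"
      obtain p q where pq: "p < q" "G = {p<..<q}"
        using admissible_deletionE[OF adm G] .
      have "c \<in> ?S" using CS cd(1) by auto
      then have "c \<noteq> q" "c \<notin> {p<..<q}"
        using c(2) G pq by (auto simp: image_iff)
      then consider "c \<le> p" | "q < c" by force
      then show "eventually (\<lambda>y. y \<notin> G) (at_left c)"
      proof cases
        case 1
        then show ?thesis
          using pq by (auto simp: eventually_at_filter)
      next
        case 2
        then show ?thesis
          using eventually_at_left_field[of _ c] pq by auto
      qed
    qed
    then have "eventually (\<lambda>y. \<forall>G\<in>\<G>. y \<notin> G) (at_left c)"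
      using adm unfolding admissible_deletion_def by (intro eventually_ball_finite) auto
    moreover have "eventually (\<lambda>y. a < y) (at_left c)"
      using c(1) eventually_at_left_field[of "\<lambda>y. a < y" c] by blast
    ultimately have "eventually (\<lambda>y. a < y \<and> (\<forall>G\<in>\<G>. y \<notin> G)) (at_left c)"
      by eventually_elim auto
    then obtain e where e: "e < c" "\<And>y. e < y \<Longrightarrow> y < c \<Longrightarrow> a < y \<and> (\<forall>G\<in>\<G>. y \<notin> G)"
      unfolding eventually_at_left_field by blast
    define y where "y = (e + c) / 2"
    have y: "e < y" "y < c" using e(1) by (auto simp: y_def)
    have "z \<in> ?S" if z: "z \<in> {y..d}" for z
    proof (cases "z < c")
      case True
      then have "a < z" "\<forall>G\<in>\<G>. z \<notin> G" using e(2)[of z] y z by auto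
      moreover have "c \<in> ?S" using CS cd(1) by auto
      ultimately show ?thesis using True by auto
    next
      case False
      then have "z \<in> {c..d}" using z by simp
      then show ?thesis using CS by blast
    qed
    then have "{y..d} \<subseteq> C"
      by (intro components_maximal[OF C]) (use y cd in auto)
    then show False using y cd by auto
  qed
  moreover have "finite \<G>"
    using adm unfolding admissible_deletion_def by blast
  ultimately show ?thesis
    by (meson finite.insertI finite_imageI finite_imageD finite_subset)
qed

lemma component_at_left_end:
  assumes adm: "admissible_deletion {a..b} \<G>"
  obtains c where "{a..c} \<in> components ({a..b} - \<Union>\<G>)"
proof -
  let ?S = "{a..b} - \<Union>\<G>"
  have "a \<notin> G" if G: "G \<in> \<G>" for G
  proof -
    obtain p q where "p < q" "G = {p<..<q}" "{p<..<q} \<subseteq> {a..b}"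
      using admissible_deletionE[OF adm G] .
    then show ?thesis by (auto simp: greaterThanLessThan_subseteq_atLeastAtMost_iff)
  qed
  then have "a \<in> ?S"
    using admissible_deletion_nondegenerate[OF adm] by auto
  then obtain C where C: "C \<in> components ?S" "a \<in> C"
    using Union_components[of ?S] by blast
  obtain c d where cd: "c \<le> d" "C = {c..d}"
    using component_of_deletion_interval[OF adm C(1)] by blast
  have "c \<in> ?S"
    using in_components_subset[OF C(1)] cd by auto
  then have "c = a" using C(2) cd by auto
  then show ?thesis using that C cd by auto
qed

text \<open>
  A window at least as long as every deleted interval cannot lie inside one of them, so if it
  meets the interval it still meets what is left.
\<close>

lemma window_meets_component:
  fixes p q :: real
  assumes adm: "admissible_deletion {a..b} \<G>"
    and gap: "\<And>G. G \<in> \<G> \<Longrightarrow> measure lborel G \<le> q - p"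
    and y: "y \<in> {a..b}" "y \<in> {p..q}"
  obtains C z where "C \<in> components ({a..b} - \<Union>\<G>)" "z \<in> C" "z \<in> {p..q}"
proof -
  let ?S = "{a..b} - \<Union>\<G>"
  have "\<exists>z\<in>?S. z \<in> {p..q}"
  proof (cases "y \<in> ?S")
    case False
    then obtain G where G: "G \<in> \<G>" "y \<in> G" using y by blast
    obtain u v where uv: "u < v" "G = {u<..<v}"
      using admissible_deletionE[OF adm G(1)] .
    have "v - u \<le> q - p" using gap[OF G(1)] uv by simp
    then have "u \<in> {p..q} \<or> v \<in> {p..q}" using G(2) uv y by auto
    then show ?thesis
      using gap_endpoints_survive[OF adm, of u v] G(1) uv by blast
  qed (use y in blast)
  then obtain z where "z \<in> ?S" "z \<in> {p..q}" by blast
  moreover from this obtain C where "C \<in> components ?S" "z \<in> C"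
    using Union_components[of ?S] by blast
  ultimately show ?thesis using that by blast
qed

text \<open>
  A component lies on one side of any given deleted interval, and there is a component on the
  other side.
\<close>

lemma component_length_le:
  assumes adm: "admissible_deletion {a..b} \<G>"
    and C: "C \<in> components ({a..b} - \<Union>\<G>)"
    and s: "\<And>C'. C' \<in> components ({a..b} - \<Union>\<G>) \<Longrightarrow> s * (b - a) \<le> measure lborel C'"
  shows "measure lborel C \<le> (1 - s) * (b - a)"
proof -
  let ?S = "{a..b} - \<Union>\<G>"
  obtain u v where uv: "u < v" "{u<..<v} \<in> \<G>"
    using admissible_deletion_ex_gap[OF adm] .
  have one_side: "d \<le> u \<or> v \<le> c" if "{c..d} \<in> components ?S" "c \<le> d" for c d
  proof (rule ccontr)
    assume *: "\<not> ?thesis"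
    \<comment> \<open>the intervals overlap, and this is the midpoint of the overlap\<close>
    have "(max c u + min d v) / 2 \<in> {c..d} \<inter> {u<..<v}"
      using * that(2) uv(1) by (auto simp: max_def min_def)
    then show False using in_components_subset[OF that(1)] uv(2) by blast
  qed
  have long: "\<exists>c d. {c..d} \<in> components ?S \<and> a \<le> c \<and> d \<le> b \<and> w \<in> {c..d} \<and> s * (b - a) \<le> d - c"
    if w: "w \<in> ?S" for w
  proof -
    obtain C' where C': "C' \<in> components ?S" "w \<in> C'"
      using w Union_components[of ?S] by blast
    obtain c d where cd: "c \<le> d" "C' = {c..d}"
      using component_of_deletion_interval[OF adm C'(1)] by blast
    have "c \<in> ?S" "d \<in> ?S"
      using in_components_subset[OF C'(1)] cd by auto
    then show ?thesis
      using C' s[OF C'(1)] cd by auto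
  qed
  obtain c d where cd: "c \<le> d" "C = {c..d}"
    using component_of_deletion_interval[OF adm C] by blast
  have "c \<in> ?S" "d \<in> ?S"
    using in_components_subset[OF C] cd by auto
  then have sub: "a \<le> c" "d \<le> b" by auto
  have ends: "u \<in> ?S" "v \<in> ?S"
    using gap_endpoints_survive[OF adm uv(2,1)] by auto
  from one_side[of c d] C cd consider "d \<le> u" | "v \<le> c" by blast
  then have "d - c \<le> (b - a) - s * (b - a)"
  proof cases
    case 1
    obtain c' d' where "{c'..d'} \<in> components ?S" "d' \<le> b" "v \<in> {c'..d'}" "s * (b - a) \<le> d' - c'"
      using long[OF ends(2)] by blast
    then show ?thesis using one_side[of c' d'] 1 sub uv(1) by auto
  next
    case 2
    obtain c' d' where "{c'..d'} \<in> components ?S" "a \<le> c'" "u \<in> {c'..d'}" "s * (b - a) \<le> d' - c'"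
      using long[OF ends(1)] by blast
    then show ?thesis using one_side[of c' d'] 2 sub uv(1) by auto
  qed
  then show ?thesis using cd by (simp add: algebra_simps)
qed

section \<open>Stages of a Cantor set construction\<close>

lemma stage_interval:
  assumes "cantor_construction A B D" "J \<in> stage A B D k"
  obtains a b where "a < b" "J = {a..b}"
proof -
  have "\<exists>a b. J = {a..b}"
    using assms(2)
  proof (induction k arbitrary: J)
    case (Suc k)
    then obtain J' where J': "J' \<in> stage A B D k" "J \<in> components (J' - \<Union>(D k J'))"
      by auto
    obtain a b where "J' = {a..b}" using Suc.IH[OF J'(1)] by blast
    moreover have "admissible_deletion J' (D k J')"
      using assms(1) J'(1) unfolding cantor_construction_def by blast
    ultimately show ?case
      using component_of_deletion_interval[of a b "D k J'" J] J'(2) by blast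
  qed auto
  then obtain a b where "J = {a..b}" by blast
  moreover have "a < b"
    using assms calculation admissible_deletion_nondegenerate
    unfolding cantor_construction_def by blast
  ultimately show ?thesis using that by blast
qed

lemma stage_admissible:
  "cantor_construction A B D \<Longrightarrow> J \<in> stage A B D k \<Longrightarrow> admissible_deletion J (D k J)"
  unfolding cantor_construction_def by blast

lemma component_in_next_stage:
  "J \<in> stage A B D k \<Longrightarrow> C \<in> components (J - \<Union>(D k J)) \<Longrightarrow> C \<in> stage A B D (Suc k)"
  by auto

lemma Union_stage_antimono: "m \<le> n \<Longrightarrow> \<Union>(stage A B D n) \<subseteq> \<Union>(stage A B D m)"
proof (induction n rule: dec_induct)
  case (step n)
  have "\<Union>(stage A B D (Suc n)) \<subseteq> \<Union>(stage A B D n)"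
  proof
    fix x assume "x \<in> \<Union>(stage A B D (Suc n))"
    then obtain J C where "J \<in> stage A B D n" "C \<in> components (J - \<Union>(D n J))" "x \<in> C"
      by auto
    then show "x \<in> \<Union>(stage A B D n)"
      using in_components_subset[of C "J - \<Union>(D n J)"] by blast
  qed
  then show ?case using step by blast
qed simp

lemma finite_stage:
  assumes "cantor_construction A B D"
  shows "finite (stage A B D k)"
proof (induction k)
  case (Suc k)
  have "finite (components (J - \<Union>(D k J)))" if J: "J \<in> stage A B D k" for J
  proof -
    obtain a b where "J = {a..b}" using stage_interval[OF assms J] by blast
    then show ?thesis
      using stage_admissible[OF assms J] finite_components_deletion by blast
  qed
  then show ?case using Suc by auto
qed simp

lemma compact_cantor_set:
  assumes "cantor_construction A B D"
  shows "compact (cantor_set A B D)"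
proof -
  have "compact J" if "J \<in> stage A B D k" for J k
    using stage_interval[OF assms that] by (metis compact_Icc)
  then have "compact (\<Union>(stage A B D k))" for k
    using finite_stage[OF assms] by (intro compact_Union) auto
  then show ?thesis
    unfolding cantor_set_def by (intro compact_Inter) auto
qed

text \<open>
  The deleted intervals are open, so the left end of a bridge is never deleted: it stays the left
  end of some bridge at all later stages.
\<close>

lemma stage_left_end_in_cantor_set:
  assumes C: "cantor_construction A B D" and J: "{a..b} \<in> stage A B D k" "a < b"
  shows "a \<in> cantor_set A B D"
proof -
  have later: "\<exists>c. a < c \<and> {a..c} \<in> stage A B D (k + n)" for n
  proof (induction n)
    case (Suc n)
    then obtain c where c: "{a..c} \<in> stage A B D (k + n)" by blast
    obtain c' where "{a..c'} \<in> components ({a..c} - \<Union>(D (k + n) {a..c}))"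
      using component_at_left_end[OF stage_admissible[OF C c]] by blast
    then have *: "{a..c'} \<in> stage A B D (k + Suc n)"
      using component_in_next_stage[OF c] by simp
    show ?case
      using * admissible_deletion_nondegenerate[OF stage_admissible[OF C *]] by blast
  qed (use J in auto)
  have "a \<in> \<Union>(stage A B D m)" for m
  proof -
    obtain c where "a < c" "{a..c} \<in> stage A B D (k + m)" using later by blast
    then have "a \<in> \<Union>(stage A B D (k + m))" by (intro UnionI[of "{a..c}"]) simp_all
    then show ?thesis using Union_stage_antimono[of m "k + m" A B D] by (meson le_add2 subsetD)
  qed
  then show ?thesis unfolding cantor_set_def by blast
qed

lemma bridge_ratio_mem:
  assumes "J \<in> stage A B D k" "C \<in> components (J - \<Union>(D k J))"
  shows "measure lborel C / measure lborel J \<in> bridge_ratios A B D"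
proof -
  have "C \<subseteq> J"
    using in_components_subset[OF assms(2)] by blast
  moreover have "C \<in> stage A B D (Suc k)"
    using component_in_next_stage[OF assms] .
  ultimately show ?thesis
    unfolding bridge_ratios_def using assms(1)
    by (intro CollectI exI[of _ C] exI[of _ J] exI[of _ k]) (intro conjI refl)
qed

lemma Inf_bridge_ratios_le:
  assumes "r \<in> bridge_ratios A B D"
  shows "Inf (bridge_ratios A B D) \<le> r"
  by (rule cInf_lower[OF assms], rule bdd_belowI[of _ 0]) (auto simp: bridge_ratios_def)

text \<open>
  From the second step on, gaps lie inside \<open>F\<^sub>1\<close> and are therefore counted.
\<close>

lemma gap_ratio_mem:
  assumes C: "cantor_construction A B D" and J: "J \<in> stage A B D k" and k: "k \<ge> 1"
    and G: "G \<in> D k J"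
  shows "measure lborel G / measure lborel J \<in> gap_ratios A B D"
proof -
  have sub: "G \<subseteq> J"
    using stage_admissible[OF C J] G unfolding admissible_deletion_def by blast
  then have "G \<subseteq> \<Union>(stage A B D 1)"
    using Union_stage_antimono[OF k, of A B D] J by blast
  then show ?thesis
    unfolding gap_ratios_def gaps_def using J G sub by blast
qed

lemma le_Sup_gap_ratios:
  assumes C: "cantor_construction A B D" and r: "r \<in> gap_ratios A B D"
  shows "r \<le> Sup (gap_ratios A B D)"
proof (rule cSup_upper[OF r], rule bdd_aboveI[of _ 1])
  fix x assume "x \<in> gap_ratios A B D"
  then obtain G J k where *: "x = measure lborel G / measure lborel J" "G \<in> gaps A B D k"
      "J \<in> stage A B D k" "G \<subseteq> J"
    unfolding gap_ratios_def by blast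
  obtain a b where ab: "a < b" "J = {a..b}" using stage_interval[OF C *(3)] .
  obtain J' where J': "J' \<in> stage A B D k" "G \<in> D k J'"
    using *(2) unfolding gaps_def by blast
  obtain u v where uv: "u < v" "G = {u<..<v}"
    using admissible_deletionE[OF stage_admissible[OF C J'(1)] J'(2)] .
  have "v - u \<le> b - a"
    using *(4) uv ab by (auto simp: greaterThanLessThan_subseteq_atLeastAtMost_iff)
  then show "x \<le> 1" using * ab uv by simp
qed

text \<open>
  A second-step gap shows that \<open>\<kappa>\<close> is positive, which in turn will force the minimal bridge
  ratio to be positive.
\<close>

lemma positive_gap_ratio:
  assumes C: "cantor_construction A B D"
  obtains r where "r \<in> gap_ratios A B D" "r > 0"
proof -
  have AB: "{A..B} \<in> stage A B D 0" by simp
  obtain c where "{A..c} \<in> components ({A..B} - \<Union>(D 0 {A..B}))"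
    using component_at_left_end[OF stage_admissible[OF C AB]] by blast
  then have J: "{A..c} \<in> stage A B D 1"
    using component_in_next_stage[OF AB] by simp
  obtain u v where uv: "u < v" "{u<..<v} \<in> D 1 {A..c}"
    using admissible_deletion_ex_gap[OF stage_admissible[OF C J]] .
  have "measure lborel {u<..<v} / measure lborel {A..c} > 0"
    using uv admissible_deletion_nondegenerate[OF stage_admissible[OF C J]] by simp
  then show ?thesis using that gap_ratio_mem[OF C J _ uv(2)] by simp
qed

section \<open>Sums of bridges\<close>

text \<open>
  Here \<open>s\<close> is any positive lower bound for the bridge ratios and \<open>\<kappa>\<close> any upper bound for the ratios
  of the gaps that are deleted after the first step.
\<close>

locale balanced_cantor_family =
  fixes S :: "'i set" and A B :: "'i \<Rightarrow> real" and D :: "'i \<Rightarrow> deletion_rule" and s \<kappa> :: real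
  assumes finite_S: "finite S" and S_ne: "S \<noteq> {}"
    and construction: "\<And>i. i \<in> S \<Longrightarrow> cantor_construction (A i) (B i) (D i)"
    and s_pos: "s > 0"
    and bridge_ge: "\<And>i k J C. \<lbrakk>i \<in> S; J \<in> stage (A i) (B i) (D i) k;
        C \<in> components (J - \<Union>(D i k J))\<rbrakk> \<Longrightarrow> s * measure lborel J \<le> measure lborel C"
    and gap_le: "\<And>i k J G. \<lbrakk>i \<in> S; k \<ge> 1; J \<in> stage (A i) (B i) (D i) k; G \<in> D i k J\<rbrakk>
        \<Longrightarrow> measure lborel G \<le> \<kappa> * measure lborel J"
    and balance: "\<And>i. i \<in> S \<Longrightarrow> \<kappa> * (B i - A i) \<le> s * (\<Sum>j\<in>S - {i}. B j - A j)"
begin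

definition scale :: "'i \<Rightarrow> real set \<Rightarrow> real" where
  "scale i J = measure lborel J / (B i - A i)"

text \<open>
  The invariant of the refinement. Stage 0 is excluded because first-step gaps are not
  controlled by \<open>\<kappa>\<close>.
\<close>

definition balanced :: "('i \<Rightarrow> nat) \<Rightarrow> ('i \<Rightarrow> real set) \<Rightarrow> bool" where
  "balanced k I \<longleftrightarrow>
     (\<forall>i\<in>S. k i \<ge> 1 \<and> I i \<in> stage (A i) (B i) (D i) (k i)) \<and>
     (\<forall>i\<in>S. \<forall>j\<in>S. s * scale j (I j) \<le> scale i (I i))"

lemma hull_pos: "i \<in> S \<Longrightarrow> A i < B i"
  using construction unfolding cantor_construction_def by blast

lemma length_eq_scale: "i \<in> S \<Longrightarrow> measure lborel J = scale i J * (B i - A i)"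
  using hull_pos[of i] by (simp add: scale_def)

lemma child_scale:
  assumes "i \<in> S" "J \<in> stage (A i) (B i) (D i) k" "C \<in> components (J - \<Union>(D i k J))"
  shows "s * scale i J \<le> scale i C" "scale i C \<le> (1 - s) * scale i J"
proof -
  note C = construction[OF assms(1)]
  obtain a b where ab: "a < b" "J = {a..b}" using stage_interval[OF C assms(2)] .
  have "measure lborel C \<le> (1 - s) * measure lborel J"
    using component_length_le[of a b "D i k J" C s] assms ab bridge_ge[OF assms(1,2)]
      stage_admissible[OF C assms(2)] by auto
  then show "scale i C \<le> (1 - s) * scale i J"
    using hull_pos[OF assms(1)] by (simp add: scale_def divide_right_mono)
  show "s * scale i J \<le> scale i C"
    using bridge_ge[OF assms] hull_pos[OF assms(1)] by (simp add: scale_def divide_right_mono)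
qed

lemma s_le_1: "s \<le> 1"
proof -
  obtain i where i: "i \<in> S" using S_ne by blast
  have AB: "{A i..B i} \<in> stage (A i) (B i) (D i) 0" by simp
  obtain c where c: "{A i..c} \<in> components ({A i..B i} - \<Union>(D i 0 {A i..B i}))"
    using component_at_left_end[OF stage_admissible[OF construction[OF i] AB]] by blast
  have "0 \<le> scale i {A i..c}" using hull_pos[OF i] by (simp add: scale_def)
  also have "\<dots> \<le> (1 - s) * scale i {A i..B i}"
    using child_scale(2)[OF i AB c] .
  also have "scale i {A i..B i} = 1" using hull_pos[OF i] by (simp add: scale_def)
  finally show ?thesis by simp
qed

lemma scale_le_power:
  assumes i: "i \<in> S" and "J \<in> stage (A i) (B i) (D i) k"
  shows "scale i J \<le> (1 - s) ^ k"
  using assms(2)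
proof (induction k arbitrary: J)
  case 0
  then show ?case using hull_pos[OF i] by (simp add: scale_def)
next
  case (Suc k)
  then obtain J' where J': "J' \<in> stage (A i) (B i) (D i) k" "J \<in> components (J' - \<Union>(D i k J'))"
    by auto
  have "scale i J \<le> (1 - s) * scale i J'" using child_scale(2)[OF i J'] .
  also have "\<dots> \<le> (1 - s) * (1 - s) ^ k"
    using Suc.IH[OF J'(1)] s_le_1 by (intro mult_left_mono) auto
  finally show ?case by simp
qed

text \<open>
  First-step bridges are children of the convex hulls, which all have relative size one.
\<close>

lemma balanced_first_stage:
  assumes "\<And>i. i \<in> S \<Longrightarrow> I i \<in> stage (A i) (B i) (D i) 1"
  shows "balanced (\<lambda>_. 1) I"
proof -
  have "s * scale j (I j) \<le> scale i (I i)" if "i \<in> S" "j \<in> S" for i j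
  proof -
    have "scale j (I j) \<le> 1 - s"
      using scale_le_power[OF that(2) assms[OF that(2)]] by simp
    then have "s * scale j (I j) \<le> s * 1"
      using s_pos by (intro mult_left_mono) auto
    also have "\<dots> = s * scale i {A i..B i}"
      using hull_pos[OF that(1)] by (simp add: scale_def)
    also have "\<dots> \<le> scale i (I i)"
      using child_scale(1)[OF that(1), of "{A i..B i}" 0 "I i"] assms[OF that(1)] by simp
    finally show ?thesis .
  qed
  then show ?thesis using assms unfolding balanced_def by auto
qed

text \<open>
  The refinement step: splitting a bridge of largest relative size loses no point of the sum, as
  balance makes the remaining summands long enough to bridge its gaps, and the child chosen is
  not too small compared with the others.
\<close>

lemma balanced_refine:
  assumes bal: "balanced k I" and x: "x \<in> (\<Sum>i\<in>S. I i)"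
  obtains k' I' where "balanced k' I'" "x \<in> (\<Sum>i\<in>S. I' i)" "sum k' S = Suc (sum k S)"
proof -
  let ?\<rho> = "\<lambda>i. scale i (I i)"
  have stage: "I i \<in> stage (A i) (B i) (D i) (k i)" "k i \<ge> 1" if "i \<in> S" for i
    using bal that unfolding balanced_def by auto
  have "Max (?\<rho> ` S) \<in> ?\<rho> ` S"
    using finite_S S_ne by (intro Max_in) auto
  then obtain i where i: "i \<in> S" "Max (?\<rho> ` S) = ?\<rho> i" by auto
  have max: "?\<rho> j \<le> ?\<rho> i" if "j \<in> S" for j
    unfolding i(2)[symmetric] using finite_S that by (intro Max_ge) auto
  note adm = stage_admissible[OF construction stage(1)]
  have "\<exists>a b. a < b \<and> I j = {a..b}" if "j \<in> S" for j
    using stage_interval[OF construction[OF that] stage(1)[OF that]] by metis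
  then obtain a b where ab: "\<And>j. j \<in> S \<Longrightarrow> a j < b j \<and> I j = {a j..b j}" by metis
  define lo where "lo = (\<Sum>j\<in>S - {i}. a j)"
  define hi where "hi = (\<Sum>j\<in>S - {i}. b j)"
  have rest: "(\<Sum>j\<in>S - {i}. I j) = {lo..hi}"
  proof -
    have "(\<Sum>j\<in>S - {i}. I j) = (\<Sum>j\<in>S - {i}. {a j..b j})"
      using ab by (intro sum.cong) auto
    also have "\<dots> = {lo..hi}"
      unfolding lo_def hi_def using ab finite_S less_imp_le by (intro sum_atLeastAtMost_sets) auto
    finally show ?thesis .
  qed
  have gap: "measure lborel G \<le> hi - lo" if G: "G \<in> D i (k i) (I i)" for G
  proof -
    have "measure lborel G \<le> \<kappa> * measure lborel (I i)"
      using gap_le[OF i(1) stage(2,1)[OF i(1)] G] i(1) by simp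
    also have "\<dots> = ?\<rho> i * (\<kappa> * (B i - A i))"
      by (subst length_eq_scale[OF i(1)]) simp
    also have "\<dots> \<le> ?\<rho> i * (s * (\<Sum>j\<in>S - {i}. B j - A j))"
      using balance[OF i(1)] hull_pos[OF i(1)] by (intro mult_left_mono) (auto simp: scale_def)
    also have "\<dots> = (\<Sum>j\<in>S - {i}. (s * ?\<rho> i) * (B j - A j))"
      by (simp add: sum_distrib_left mult_ac)
    also have "\<dots> \<le> (\<Sum>j\<in>S - {i}. ?\<rho> j * (B j - A j))"
      using bal i(1) hull_pos less_imp_le unfolding balanced_def
      by (intro sum_mono mult_right_mono) auto
    also have "\<dots> = (\<Sum>j\<in>S - {i}. b j - a j)"
    proof (rule sum.cong)
      fix j assume "j \<in> S - {i}"
      then have j: "j \<in> S" by simp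
      show "?\<rho> j * (B j - A j) = b j - a j"
        using length_eq_scale[OF j, of "I j"] ab[OF j] by auto
    qed simp
    finally show ?thesis by (simp add: lo_def hi_def sum_subtractf)
  qed
  \<comment> \<open>the \<open>i\<close>-th summand may be any point of the window from \<open>x - hi\<close> to \<open>x - lo\<close>\<close>
  obtain y where y: "y \<in> I i" "x - y \<in> {lo..hi}"
  proof -
    have "x \<in> I i + (\<Sum>j\<in>S - {i}. I j)"
      using x sum.remove[OF finite_S i(1), of I] by simp
    then show ?thesis using that unfolding rest by (auto elim!: set_plus_elim)
  qed
  obtain C z where C: "C \<in> components (I i - \<Union>(D i (k i) (I i)))"
    and z: "z \<in> C" "z \<in> {x - hi..x - lo}"
    using window_meets_component[of "a i" "b i" "D i (k i) (I i)" "x - lo" "x - hi" y]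
      adm[OF i(1) i(1)] ab[OF i(1)] gap y by auto
  define k' where "k' = k(i := Suc (k i))"
  define I' where "I' = I(i := C)"
  have "balanced k' I'"
    unfolding balanced_def
  proof (intro conjI ballI)
    fix j assume j: "j \<in> S"
    show "k' j \<ge> 1" "I' j \<in> stage (A j) (B j) (D j) (k' j)"
      using stage[OF j] component_in_next_stage[OF stage(1)[OF i(1)] C]
      by (auto simp: k'_def I'_def)
  next
    fix j l assume jl: "j \<in> S" "l \<in> S"
    have "scale i C \<le> (1 - s) * ?\<rho> i" using child_scale(2)[OF i(1) stage(1)[OF i(1)] C] .
    also have "\<dots> \<le> 1 * ?\<rho> i"
      using s_pos hull_pos[OF i(1)] by (intro mult_right_mono) (auto simp: scale_def)
    finally have "scale i C \<le> ?\<rho> i" by simp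
    then have "scale l (I' l) \<le> ?\<rho> i"
      using max[OF jl(2)] by (simp add: I'_def)
    then have "s * scale l (I' l) \<le> s * ?\<rho> i"
      using s_pos by simp
    also have "\<dots> \<le> scale j (I' j)"
      using child_scale(1)[OF i(1) stage(1)[OF i(1)] C] bal i(1) jl
      unfolding balanced_def by (simp add: I'_def)
    finally show "s * scale l (I' l) \<le> scale j (I' j)" .
  qed
  moreover have "x \<in> (\<Sum>j\<in>S. I' j)"
  proof -
    have "(\<Sum>j\<in>S. I' j) = C + (\<Sum>j\<in>S - {i}. I j)"
      using sum.remove[OF finite_S i(1), of I'] sum.cong[of "S - {i}" "S - {i}" I' I]
      by (simp add: I'_def)
    then have "(\<Sum>j\<in>S. I' j) = C + {lo..hi}" by (simp add: rest)
    then show ?thesis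
      using set_plus_intro[of z C "x - z" "{lo..hi}"] z by auto
  qed
  moreover have "sum k' S = Suc (sum k S)"
    using sum.remove[OF finite_S i(1), of k'] sum.remove[OF finite_S i(1), of k]
      sum.cong[of "S - {i}" "S - {i}" k' k]
    by (simp add: k'_def)
  ultimately show ?thesis using that by blast
qed

text \<open>
  Enough refinements push at least one bridge beyond stage \<open>N\<close>, so this bridge is small, and by
  balance none of the others can be much larger.
\<close>

lemma balanced_scale_small:
  assumes "balanced k I" "card S * N \<le> sum k S" "j \<in> S"
  shows "scale j (I j) \<le> (1 - s) ^ N / s"
proof -
  obtain i where i: "i \<in> S" "N \<le> k i"
  proof (rule ccontr)
    assume "\<not> thesis"
    then have "sum k S < card S * N"
      using sum_bounded_above_strict[of S k N] finite_S S_ne that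
      by (auto simp: card_gt_0_iff not_le[symmetric])
    then show False using assms(2) by simp
  qed
  have "s * scale j (I j) \<le> scale i (I i)"
    using assms i unfolding balanced_def by blast
  also have "\<dots> \<le> (1 - s) ^ k i"
    using assms i scale_le_power unfolding balanced_def by blast
  also have "\<dots> \<le> (1 - s) ^ N"
    using i s_pos s_le_1 by (intro power_decreasing) auto
  finally show ?thesis using s_pos by (simp add: field_simps)
qed

text \<open>
  A point of the sum lies in sums of arbitrarily small bridges, hence arbitrarily close to sums of
  left ends of bridges, and these are points of the Cantor sets.
\<close>

lemma sum_first_stage_subset:
  assumes "\<And>i. i \<in> S \<Longrightarrow> I i \<in> stage (A i) (B i) (D i) 1"
  shows "(\<Sum>i\<in>S. I i) \<subseteq> (\<Sum>i\<in>S. cantor_set (A i) (B i) (D i))"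
proof
  fix x assume x: "x \<in> (\<Sum>i\<in>S. I i)"
  let ?K = "\<Sum>i\<in>S. cantor_set (A i) (B i) (D i)"
  have deep: "\<exists>k I. balanced k I \<and> x \<in> sum I S \<and> n \<le> sum k S" for n
  proof (induction n)
    case 0
    then show ?case using balanced_first_stage[OF assms] x by blast
  next
    case (Suc n)
    then obtain k I where "balanced k I" "x \<in> sum I S" "n \<le> sum k S" by blast
    then show ?case using balanced_refine[of k I x] by (metis Suc_le_mono)
  qed
  have approx: "\<exists>y\<in>?K. dist y x \<le> (1 - s) ^ N / s * (\<Sum>i\<in>S. B i - A i)" for N
  proof -
    obtain k I where I: "balanced k I" "x \<in> sum I S" "card S * N \<le> sum k S"
      using deep by blast
    then have "\<exists>a b. a < b \<and> I j = {a..b}" if "j \<in> S" for j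
      using stage_interval[OF construction[OF that]] that unfolding balanced_def by metis
    then obtain a b where ab: "\<And>j. j \<in> S \<Longrightarrow> a j < b j \<and> I j = {a j..b j}" by metis
    have "a j \<in> cantor_set (A j) (B j) (D j)" if "j \<in> S" for j
      using stage_left_end_in_cantor_set[OF construction[OF that]] ab[OF that] I(1) that
      unfolding balanced_def by metis
    then have "sum a S \<in> ?K"
      using set_sum_alt[OF finite_S] by blast
    moreover have "dist (sum a S) x \<le> (1 - s) ^ N / s * (\<Sum>i\<in>S. B i - A i)"
    proof -
      have "sum I S = (\<Sum>j\<in>S. {a j..b j})"
        using ab by (intro sum.cong) auto
      also have "\<dots> = {sum a S..sum b S}"
        using ab finite_S less_imp_le by (intro sum_atLeastAtMost_sets) auto
      finally have "dist (sum a S) x \<le> (\<Sum>j\<in>S. b j - a j)"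
        using I(2) by (simp add: dist_real_def sum_subtractf)
      also have "\<dots> \<le> (\<Sum>j\<in>S. (1 - s) ^ N / s * (B j - A j))"
      proof (rule sum_mono)
        fix j assume j: "j \<in> S"
        have "b j - a j = scale j (I j) * (B j - A j)"
          using length_eq_scale[OF j, of "I j"] ab[OF j] by auto
        also have "\<dots> \<le> (1 - s) ^ N / s * (B j - A j)"
          using balanced_scale_small[OF I(1,3) j] hull_pos[OF j] by (intro mult_right_mono) auto
        finally show "b j - a j \<le> (1 - s) ^ N / s * (B j - A j)" .
      qed
      finally show ?thesis by (simp add: sum_distrib_left)
    qed
    ultimately show ?thesis by blast
  qed
  have "(\<lambda>N. (1 - s) ^ N / s * (\<Sum>i\<in>S. B i - A i)) \<longlonglongrightarrow> 0 / s * (\<Sum>i\<in>S. B i - A i)"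
    using s_pos s_le_1 by (intro tendsto_intros LIMSEQ_power_zero) auto
  then have lim: "(\<lambda>N. (1 - s) ^ N / s * (\<Sum>i\<in>S. B i - A i)) \<longlonglongrightarrow> 0" by simp
  have "x \<in> closure ?K"
    unfolding closure_approachable
  proof (intro allI impI)
    fix e :: real assume "e > 0"
    then obtain N where "(1 - s) ^ N / s * (\<Sum>i\<in>S. B i - A i) < e"
      using order_tendstoD(2)[OF lim, of e] unfolding eventually_sequentially by blast
    then show "\<exists>y\<in>?K. dist y x < e" using approx[of N] le_less_trans by blast
  qed
  moreover have "closed ?K"
    by (intro compact_imp_closed compact_sum_sets finite_S compact_cantor_set construction)
  ultimately show "x \<in> ?K" by simp
qed

lemma sum_cantor_sets_eq:
  "(\<Sum>i\<in>S. cantor_set (A i) (B i) (D i)) =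
     (\<Union>I\<in>PiE S (\<lambda>i. stage (A i) (B i) (D i) 1). \<Sum>i\<in>S. I i)" (is "?K = ?U")
proof
  show "?U \<subseteq> ?K"
    using sum_first_stage_subset by (force simp: PiE_iff)
  show "?K \<subseteq> ?U"
  proof
    fix x assume "x \<in> ?K"
    then obtain y where y: "x = sum y S" "\<forall>i\<in>S. y i \<in> cantor_set (A i) (B i) (D i)"
      unfolding set_sum_alt[OF finite_S] by blast
    have "\<exists>J. J \<in> stage (A i) (B i) (D i) 1 \<and> y i \<in> J" if "i \<in> S" for i
      using y(2) that unfolding cantor_set_def by blast
    then obtain I where I: "\<And>i. i \<in> S \<Longrightarrow> I i \<in> stage (A i) (B i) (D i) 1 \<and> y i \<in> I i" by metis
    then have "x \<in> sum (restrict I S) S"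
      unfolding set_sum_alt[OF finite_S] using y(1) by auto
    moreover have "restrict I S \<in> PiE S (\<lambda>i. stage (A i) (B i) (D i) 1)"
      using I by auto
    ultimately show "x \<in> ?U" by blast
  qed
qed

lemma sum_cantor_sets_finite_union:
  "\<exists>\<J>. finite \<J> \<and> (\<forall>J\<in>\<J>. \<exists>a b::real. a < b \<and> J = {a..b}) \<and>
     (\<Sum>i\<in>S. cantor_set (A i) (B i) (D i)) = \<Union>\<J>"
proof -
  let ?P = "PiE S (\<lambda>i. stage (A i) (B i) (D i) 1)"
  let ?\<J> = "(\<lambda>I. sum I S) ` ?P"
  have "finite ?P"
    using finite_S by (rule finite_PiE) (rule finite_stage[OF construction])
  then have "finite ?\<J>" by (rule finite_imageI)
  moreover have "\<exists>a b. a < b \<and> sum I S = {a..b}" if I: "I \<in> ?P" for I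
  proof -
    have "\<exists>a b. a < b \<and> I j = {a..b}" if j: "j \<in> S" for j
      using stage_interval[OF construction[OF j] PiE_mem[OF I j]] by metis
    then obtain a b where ab: "\<And>j. j \<in> S \<Longrightarrow> a j < b j \<and> I j = {a j..b j}" by metis
    have "sum I S = (\<Sum>j\<in>S. {a j..b j})"
      using ab by (intro sum.cong) auto
    also have "\<dots> = {sum a S..sum b S}"
      using ab finite_S less_imp_le by (intro sum_atLeastAtMost_sets) auto
    finally have "sum I S = {sum a S..sum b S}" .
    moreover have "sum a S < sum b S"
      using ab finite_S S_ne by (intro sum_strict_mono) auto
    ultimately show ?thesis by blast
  qed
  ultimately show ?thesis
    unfolding sum_cantor_sets_eq by (intro exI[of _ ?\<J>]) blast
qed

end

section \<open>The sum of the Cantor sets\<close>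

theorem corollary1p5:
  fixes d :: nat and A B :: "nat \<Rightarrow> real" and D :: "nat \<Rightarrow> deletion_rule"
  assumes "d \<ge> 2"
    and "\<And>i. i \<in> {1..d} \<Longrightarrow> cantor_construction (A i) (B i) (D i)"
    and "\<And>i. i \<in> {1..d} \<Longrightarrow>
      s_min d A B D * (\<Sum>j\<in>{1..d} - {i}. B j - A j) - kappa d A B D * (B i - A i) \<ge> 0"
  shows "\<exists>\<J>. finite \<J> \<and> (\<forall>J\<in>\<J>. \<exists>a b. a < b \<and> J = {a..b}) \<and>
    {\<Sum>i\<in>{1..d}. x i | x. \<forall>i\<in>{1..d}. x i \<in> cantor_set (A i) (B i) (D i)} = \<Union>\<J>"
proof -
  let ?s = "s_min d A B D" and ?\<kappa> = "kappa d A B D"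
  have s_le: "?s \<le> Inf (bridge_ratios (A i) (B i) (D i))" if "i \<in> {1..d}" for i
    unfolding s_min_def using that by (intro Min_le) auto
  have \<kappa>_ge: "r \<le> ?\<kappa>" if i: "i \<in> {1..d}" and r: "r \<in> gap_ratios (A i) (B i) (D i)" for i r
  proof -
    have "r \<le> Sup (gap_ratios (A i) (B i) (D i))"
      using le_Sup_gap_ratios[OF assms(2)[OF i] r] .
    also have "\<dots> \<le> ?\<kappa>"
      unfolding kappa_def using i by (intro Max_ge) auto
    finally show ?thesis .
  qed
  have len_pos: "measure lborel J > 0"
    if "i \<in> {1..d}" "J \<in> stage (A i) (B i) (D i) k" for i J k
    using stage_interval[OF assms(2)[OF that(1)] that(2)] by fastforce
  have one: "1 \<in> {1..d}" using assms(1) by simp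
  have hull: "A j < B j" if "j \<in> {1..d}" for j
    using assms(2)[OF that] unfolding cantor_construction_def by blast
  \<comment> \<open>the hypothesis for \<open>i = 1\<close> bounds a positive number by a multiple of the bridge ratio\<close>
  have "?\<kappa> > 0"
    using positive_gap_ratio[OF assms(2)[OF one]] \<kappa>_ge[OF one] by (metis less_le_trans)
  then have "0 < ?\<kappa> * (B 1 - A 1)" using hull[OF one] by simp
  also have "\<dots> \<le> ?s * (\<Sum>j\<in>{1..d} - {1}. B j - A j)" using assms(3)[OF one] by simp
  finally have "0 < ?s * (\<Sum>j\<in>{1..d} - {1}. B j - A j)" .
  moreover have "0 \<le> (\<Sum>j\<in>{1..d} - {1}. B j - A j)"
    using hull less_imp_le by (intro sum_nonneg) auto
  ultimately have s_pos: "?s > 0" by (simp add: zero_less_mult_iff)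
  interpret balanced_cantor_family "{1..d}" A B D ?s ?\<kappa>
  proof
    show "finite {1..d}" "{1..d} \<noteq> {}" using one by auto
    show "?s > 0" by (rule s_pos)
  next
    fix i assume "i \<in> {1..d}"
    then show "cantor_construction (A i) (B i) (D i)"
      and "?\<kappa> * (B i - A i) \<le> ?s * (\<Sum>j\<in>{1..d} - {i}. B j - A j)"
      using assms(2,3)[of i] by auto
  next
    fix i k J C
    assume *: "i \<in> {1..d}" "J \<in> stage (A i) (B i) (D i) k" "C \<in> components (J - \<Union>(D i k J))"
    have "?s \<le> measure lborel C / measure lborel J"
      using s_le[OF *(1)] Inf_bridge_ratios_le[OF bridge_ratio_mem[OF *(2,3)]] by linarith
    then show "?s * measure lborel J \<le> measure lborel C"
      using len_pos[OF *(1,2)] by (simp add: field_simps)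
  next
    fix i k J G
    assume *: "i \<in> {1..d}" "k \<ge> 1" "J \<in> stage (A i) (B i) (D i) k" "G \<in> D i k J"
    show "measure lborel G \<le> ?\<kappa> * measure lborel J"
      using \<kappa>_ge[OF *(1) gap_ratio_mem[OF assms(2)[OF *(1)] *(3,2,4)]] len_pos[OF *(1,3)]
      by (simp add: field_simps)
  qed
  show ?thesis
    using sum_cantor_sets_finite_union unfolding set_sum_alt[OF finite_S] by simp
qed

end
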